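(* Suppose that $0<\tau<\frac{1+\sqrt5}{2}$ and $\beta>\bar\beta$, where $$\bar\beta=\max\left\{\max\{1/\tau,\tau\}\cdot\lambda_{\max},\ -\frac{\lambda_{\min}}{2}+\frac12\sqrt{\lambda_{\min}^2+\max\left\{\frac1\tau,\frac{\tau^2}{1+\tau-\tau^2}\right\}\cdot8\lambda_{\max}^2}\right\}.$$ If the initialization $(L^0,S^0,Z^0,\Lambda^0)$ is chosen with $(L^0,S^0)\in\operatorname{dom}\Psi\times\operatorname{dom}\Phi$ and $$\Lambda^0=\mathcal{A}^*(D-\mathcal{A}(Z^0)),$$ then the first iterate $(L^1,S^1,Z^1,\Lambda^1)$ generated from it by the ADMM described in the context satisfies $$\Theta_{\tau,\beta}(L^1,S^1,Z^1,\Lambda^1)\le\Theta_{\tau,\beta}(L^0,S^0,Z^0,\Lambda^0).$$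
   Context: Setting. $\mathbb{R}^{m\times n}$ carries the trace inner product $\langle X,Y\rangle=\sum_{i,j}x_{ij}y_{ij}$ and Frobenius norm $\|\cdot\|_F$. $D\in\mathbb{R}^{m\times n}$ is given. $\Psi,\Phi:\mathbb{R}^{m\times n}\to\mathbb{R}_+\cup\{\infty\}$ are proper closed (lower semicontinuous) nonnegative functions, $\Psi$ is convex, $\Phi$ is possibly nonconvex and nonsmooth; $\operatorname{dom}f=\{X:f(X)<\infty\}$. $\mathcal{A},\mathcal{B},\mathcal{C}:\mathbb{R}^{m\times n}\to\mathbb{R}^{m\times n}$ are linear maps with $\mathcal{B},\mathcal{C}$ injective; $^*$ denotes the adjoint. $\lambda_{\max}$ and $\lambda_{\min}$ are the largest and smallest eigenvalues of $\mathcal{A}^*\mathcal{A}$. The problem is $\min_{L,S}\Psi(L)+\Phi(S)+\frac12\|D-\mathcal{A}[\mathcal{B}(L)+\mathcal{C}(S)]\|_F^2$. Its augmented Lagrangian (after introducing $Z=\mathcal{B}(L)+\mathcal{C}(S)$), with penalty parameter $\beta>0$, is $$\mathcal{L}_\beta(L,S,Z,\Lambda)=\Psi(L)+\Phi(S)+\tfrac12\|D-\mathcal{A}(Z)\|_F^2-\langle\Lambda,\mathcal{B}(L)+\mathcal{C}(S)-Z\rangle+\tfrac\beta2\|\mathcal{B}(L)+\mathcal{C}(S)-Z\|_F^2 .$$ ADMM. Given an initial point $(S^0,Z^0,\Lambda^0)$ (the value $L^0$ does not enter the iteration), dual step-size $\tau>0$ and $\beta>0$, for $k=0,1,2,\dots$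 a sequence generated by the ADMM satisfies $L^{k+1}\in\operatorname{Argmin}_L\mathcal{L}_\beta(L,S^k,Z^k,\Lambda^k)$; $S^{k+1}\in\operatorname{Argmin}_S\mathcal{L}_\beta(L^{k+1},S,Z^k,\Lambda^k)$; $Z^{k+1}=\operatorname{argmin}_Z\mathcal{L}_\beta(L^{k+1},S^{k+1},Z,\Lambda^k)$; $\Lambda^{k+1}=\Lambda^k-\tau\beta(\mathcal{B}(L^{k+1})+\mathcal{C}(S^{k+1})-Z^{k+1})$. Potential function. For $0<\tau<\frac{1+\sqrt5}{2}$, let $\theta(\tau)=\max\left\{1-\tau,\frac{(\tau-1)\tau^2}{1+\tau-\tau^2}\right\}$ and $$\Theta_{\tau,\beta}(L,S,Z,\Lambda)=\mathcal{L}_\beta(L,S,Z,\Lambda)+\theta(\tau)\beta\|\mathcal{B}(L)+\mathcal{C}(S)-Z\|_F^2 .$$ *)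

theory Defs
  imports "HOL-Analysis.Analysis"
begin

text \<open>
  Everything is stated over an abstract Euclidean space \<open>'a\<close>.  At the type \<open>real ^ 'n ^ 'm\<close> of
  real matrices with rows indexed by \<open>'m\<close> and columns by \<open>'n\<close>, the library's \<open>inner\<close> is the trace
  inner product (the sum over all i, j of x_ij * y_ij) and \<open>norm\<close> is the Frobenius norm.

  Functions with values in the nonnegative reals extended by infinity are modelled as \<open>ereal\<close>-valued
  functions together with an explicit nonnegativity hypothesis, because the augmented Lagrangian
  may take negative values.
\<close>

definition edom :: "('a \<Rightarrow> ereal) \<Rightarrow> 'a set" where
  "edom f = {x. f x < \<infinity>}"

definition eproper :: "('a \<Rightarrow> ereal) \<Rightarrow> bool" where
  "eproper f \<longleftrightarrow> edom f \<noteq> {} \<and> (\<forall>x. f x > -\<infinity>)"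

text \<open>The filter \<open>at x\<close> is punctured, which makes no difference for this inequality.\<close>

definition lower_semicontinuous :: "('a::topological_space \<Rightarrow> ereal) \<Rightarrow> bool" where
  "lower_semicontinuous f \<longleftrightarrow> (\<forall>x. f x \<le> Liminf (at x) f)"

text \<open>
  For \<open>t = 0\<close> and \<open>t = 1\<close> the \<open>ereal\<close> convention that zero times infinity is zero makes the
  inequality trivial, as it should be.
\<close>

definition econvex :: "('a::real_vector \<Rightarrow> ereal) \<Rightarrow> bool" where
  "econvex f \<longleftrightarrow> (\<forall>x y t. 0 \<le> t \<longrightarrow> t \<le> 1 \<longrightarrow>
     f ((1 - t) *\<^sub>R x + t *\<^sub>R y) \<le> ereal (1 - t) * f x + ereal t * f y)"

definition eigenvalues :: "('a::real_vector \<Rightarrow> 'a) \<Rightarrow> real set" where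
  "eigenvalues T = {\<mu>. \<exists>x. x \<noteq> 0 \<and> T x = \<mu> *\<^sub>R x}"

text \<open>
  For a linear map \<open>A\<close> on a finite-dimensional space the set of eigenvalues of the self-adjoint
  map \<open>adjoint A \<circ> A\<close> is finite and nonempty, so \<open>Max\<close> and \<open>Min\<close> are meaningful.
\<close>

definition lambda_max :: "('a::euclidean_space \<Rightarrow> 'a) \<Rightarrow> real" where
  "lambda_max A = Max (eigenvalues (adjoint A \<circ> A))"

definition lambda_min :: "('a::euclidean_space \<Rightarrow> 'a) \<Rightarrow> real" where
  "lambda_min A = Min (eigenvalues (adjoint A \<circ> A))"

definition aug_lagrangian ::
  "('a::euclidean_space \<Rightarrow> ereal) \<Rightarrow> ('a \<Rightarrow> ereal) \<Rightarrow> ('a \<Rightarrow> 'a) \<Rightarrow> ('a \<Rightarrow> 'a) \<Rightarrow> ('a \<Rightarrow> 'a) \<Rightarrow>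
    'a \<Rightarrow> real \<Rightarrow> 'a \<Rightarrow> 'a \<Rightarrow> 'a \<Rightarrow> 'a \<Rightarrow> ereal" where
  "aug_lagrangian \<Psi> \<Phi> A B C D \<beta> L S Z \<Lambda> =
     \<Psi> L + \<Phi> S +
     ereal (1 / 2 * (norm (D - A Z))\<^sup>2 - \<Lambda> \<bullet> (B L + C S - Z) + \<beta> / 2 * (norm (B L + C S - Z))\<^sup>2)"

text \<open>
  One iteration of the ADMM, from the current \<open>(S, Z, \<Lambda>)\<close> to the next \<open>(L', S', Z', \<Lambda>')\<close>; the
  current \<open>L\<close> does not enter.  Each minimisation is over the whole space.  The minimiser in \<open>Z\<close> is
  unique for \<open>\<beta> > 0\<close> by strong convexity, so being a minimiser determines \<open>Z'\<close>.
\<close>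

definition admm_step ::
  "('a::euclidean_space \<Rightarrow> ereal) \<Rightarrow> ('a \<Rightarrow> ereal) \<Rightarrow> ('a \<Rightarrow> 'a) \<Rightarrow> ('a \<Rightarrow> 'a) \<Rightarrow> ('a \<Rightarrow> 'a) \<Rightarrow>
    'a \<Rightarrow> real \<Rightarrow> real \<Rightarrow> 'a \<times> 'a \<times> 'a \<Rightarrow> 'a \<times> 'a \<times> 'a \<times> 'a \<Rightarrow> bool" where
  "admm_step \<Psi> \<Phi> A B C D \<beta> \<tau> = (\<lambda>(S, Z, \<Lambda>) (L', S', Z', \<Lambda>').
     is_arg_min (\<lambda>X. aug_lagrangian \<Psi> \<Phi> A B C D \<beta> X S Z \<Lambda>) (\<lambda>_. True) L' \<and>
     is_arg_min (\<lambda>X. aug_lagrangian \<Psi> \<Phi> A B C D \<beta> L' X Z \<Lambda>) (\<lambda>_. True) S' \<and>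
     is_arg_min (\<lambda>X. aug_lagrangian \<Psi> \<Phi> A B C D \<beta> L' S' X \<Lambda>) (\<lambda>_. True) Z' \<and>
     \<Lambda>' = \<Lambda> - (\<tau> * \<beta>) *\<^sub>R (B L' + C S' - Z'))"

definition theta :: "real \<Rightarrow> real" where
  "theta \<tau> = max (1 - \<tau>) ((\<tau> - 1) * \<tau>\<^sup>2 / (1 + \<tau> - \<tau>\<^sup>2))"

definition potential ::
  "('a::euclidean_space \<Rightarrow> ereal) \<Rightarrow> ('a \<Rightarrow> ereal) \<Rightarrow> ('a \<Rightarrow> 'a) \<Rightarrow> ('a \<Rightarrow> 'a) \<Rightarrow> ('a \<Rightarrow> 'a) \<Rightarrow>
    'a \<Rightarrow> real \<Rightarrow> real \<Rightarrow> 'a \<Rightarrow> 'a \<Rightarrow> 'a \<Rightarrow> 'a \<Rightarrow> ereal" where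
  "potential \<Psi> \<Phi> A B C D \<tau> \<beta> L S Z \<Lambda> =
     aug_lagrangian \<Psi> \<Phi> A B C D \<beta> L S Z \<Lambda> + ereal (theta \<tau> * \<beta> * (norm (B L + C S - Z))\<^sup>2)"

definition beta_bar :: "('a::euclidean_space \<Rightarrow> 'a) \<Rightarrow> real \<Rightarrow> real" where
  "beta_bar A \<tau> =
     max (max (1 / \<tau>) \<tau> * lambda_max A)
         (- (lambda_min A / 2) +
          1 / 2 * sqrt ((lambda_min A)\<^sup>2 +
            max (1 / \<tau>) (\<tau>\<^sup>2 / (1 + \<tau> - \<tau>\<^sup>2)) * (8 * (lambda_max A)\<^sup>2)))"

end

theory Submission
  imports Defs
begin

text \<open>
  Write d = Z1 - Z0 and r1 = B L1 + C S1 - Z1.  Because of the special choice of the initial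
  multiplier, the optimality condition of the Z-step reads \<open>\<beta> r1 = A\<^sup>* A d\<close>.  The L- and S-steps do
  not increase the augmented Lagrangian, the Z-step decreases it by exactly
  \<open>(\<parallel>A d\<parallel>\<^sup>2 + \<beta> \<parallel>d\<parallel>\<^sup>2) / 2\<close>, and the multiplier step increases it by \<open>\<tau> \<beta> \<parallel>r1\<parallel>\<^sup>2\<close>.  As \<open>\<theta>(\<tau>) \<ge> 0\<close>,
  it is enough that \<open>2 (\<tau> + \<theta>(\<tau>)) \<lambda>\<^sub>m\<^sub>a\<^sub>x\<^sup>2 \<le> \<beta> (\<beta> + \<lambda>\<^sub>m\<^sub>i\<^sub>n)\<close>, and this is what the second term
  in the definition of the threshold on \<open>\<beta>\<close> guarantees.
\<close>

section \<open>Extreme eigenvalues of self-adjoint maps\<close>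

lemma quadratic_nonneg_imp_linear_coeff_zero:
  fixes b c :: real
  assumes nonneg: "\<And>t. 0 \<le> b * t + c * t\<^sup>2"
  shows "b = 0"
proof (rule ccontr)
  assume "b \<noteq> 0"
  \<comment> \<open>The denominator stays positive even for \<open>c = 0\<close>, and with
    \<open>c\<close> replaced by its absolute value the polynomial at this \<open>t\<close> has a
    closed negative form.\<close>
  define t where "t = - b / (\<bar>c\<bar> + 1)"
  have "b * t + c * t\<^sup>2 \<le> b * t + \<bar>c\<bar> * t\<^sup>2"
    by (simp add: mult_right_mono)
  also have "\<dots> = - (b\<^sup>2) / (\<bar>c\<bar> + 1)\<^sup>2"
    unfolding t_def by (simp add: divide_simps power2_eq_square) (simp add: algebra_simps)
  also have "\<dots> < 0"
    using \<open>b \<noteq> 0\<close> by (intro divide_neg_pos) auto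
  finally show False
    using nonneg[of t] by simp
qed

text \<open>Along the line from \<open>x\<close> in direction \<open>H x\<close> the quadratic form
  is a nonnegative polynomial in t without constant term. Its linear coefficient is twice the
  squared norm of \<open>H x\<close>, hence must vanish.\<close>

lemma psd_self_adjoint_inner_zero_imp_zero:
  fixes H :: "'a::real_inner \<Rightarrow> 'a"
  assumes lin: "linear H" and sa: "\<And>x y. H x \<bullet> y = x \<bullet> H y"
    and psd: "\<And>x. 0 \<le> H x \<bullet> x" and zero: "H x \<bullet> x = 0"
  shows "H x = 0"
proof -
  have "0 \<le> (2 * (H x \<bullet> H x)) * t + (H (H x) \<bullet> H x) * t\<^sup>2" for t
  proof -
    have "H (x + t *\<^sub>R H x) \<bullet> (x + t *\<^sub>R H x) = 2 * (H x \<bullet> H x) * t + (H (H x) \<bullet> H x) * t\<^sup>2"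
      using zero sa[of "H x" x]
      by (simp add: linear_add[OF lin] linear_scale[OF lin] inner_add power2_eq_square algebra_simps)
    then show ?thesis
      using psd[of "x + t *\<^sub>R H x"] by simp
  qed
  then have "2 * (H x \<bullet> H x) = 0"
    by (rule quadratic_nonneg_imp_linear_coeff_zero)
  then show ?thesis by simp
qed

text \<open>By compactness the quadratic form attains its minimum \<mu> over the unit sphere at some
  \<open>v\<close>. Subtracting \<mu> times the identity leaves a positive semidefinite map whose
  form vanishes at \<open>v\<close>, so \<open>v\<close> lies in its kernel.\<close>

lemma self_adjoint_least_eigenvalue:
  fixes T :: "'a::euclidean_space \<Rightarrow> 'a"
  assumes lin: "linear T" and sa: "\<And>x y. T x \<bullet> y = x \<bullet> T y"
  obtains \<mu> where "\<mu> \<in> eigenvalues T" and "\<And>x. \<mu> * (norm x)\<^sup>2 \<le> T x \<bullet> x"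
proof -
  have cont: "continuous_on (sphere 0 1) (\<lambda>x. T x \<bullet> x)"
    using lin by (intro continuous_intros linear_continuous_on) (simp add: linear_conv_bounded_linear)
  have "sphere (0::'a) 1 \<noteq> {}" by simp
  then obtain v where v: "v \<in> sphere 0 1" and min: "\<forall>y\<in>sphere 0 1. T v \<bullet> v \<le> T y \<bullet> y"
    using continuous_attains_inf[OF compact_sphere _ cont] by blast
  define \<mu> where "\<mu> = T v \<bullet> v"
  have bound: "\<mu> * (norm x)\<^sup>2 \<le> T x \<bullet> x" for x
  proof (cases "x = 0")
    case False
    have "(1 / norm x) *\<^sub>R x \<in> sphere 0 1"
      using False by simp
    then have "\<mu> \<le> T ((1 / norm x) *\<^sub>R x) \<bullet> ((1 / norm x) *\<^sub>R x)"
      using min \<mu>_def by blast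
    also have "\<dots> = (T x \<bullet> x) / (norm x)\<^sup>2"
      by (simp add: linear_scale[OF lin] power2_eq_square)
    finally show ?thesis
      using False by (simp add: pos_le_divide_eq)
  qed (simp add: linear_0[OF lin])
  have "T v - \<mu> *\<^sub>R v = 0"
  proof (rule psd_self_adjoint_inner_zero_imp_zero[where H = "\<lambda>x. T x - \<mu> *\<^sub>R x"])
    show "linear (\<lambda>x. T x - \<mu> *\<^sub>R x)"
      by (intro linear_compose_sub lin linear_scaleR)
    show "0 \<le> (T x - \<mu> *\<^sub>R x) \<bullet> x" for x
      using bound[of x] by (simp add: inner_diff_left power2_norm_eq_inner)
    show "(T v - \<mu> *\<^sub>R v) \<bullet> v = 0"
      using v by (simp add: inner_diff_left \<mu>_def norm_eq_1)
  qed (simp add: inner_diff sa)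
  moreover have "v \<noteq> 0"
    using v by auto
  ultimately have "\<mu> \<in> eigenvalues T"
    unfolding eigenvalues_def by auto
  then show thesis
    using bound that by blast
qed

lemma self_adjoint_greatest_eigenvalue:
  fixes T :: "'a::euclidean_space \<Rightarrow> 'a"
  assumes lin: "linear T" and sa: "\<And>x y. T x \<bullet> y = x \<bullet> T y"
  obtains \<mu> where "\<mu> \<in> eigenvalues T" and "\<And>x. T x \<bullet> x \<le> \<mu> * (norm x)\<^sup>2"
proof -
  obtain \<mu> where \<mu>: "\<mu> \<in> eigenvalues (\<lambda>x. - T x)" "\<And>x. \<mu> * (norm x)\<^sup>2 \<le> (- T x) \<bullet> x"
    using self_adjoint_least_eigenvalue[of "\<lambda>x. - T x"] lin sa
    by (metis inner_minus_left inner_minus_right linear_compose_neg)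
  obtain x where x: "x \<noteq> 0" "- T x = \<mu> *\<^sub>R x"
    using \<mu>(1) unfolding eigenvalues_def by auto
  have "T x = (- \<mu>) *\<^sub>R x"
    using x(2) by (metis minus_minus scaleR_minus_left)
  then have "- \<mu> \<in> eigenvalues T"
    unfolding eigenvalues_def using x(1) by blast
  moreover have "T x \<bullet> x \<le> (- \<mu>) * (norm x)\<^sup>2" for x
    using \<mu>(2)[of x] by simp
  ultimately show thesis
    using that by blast
qed

text \<open>Eigenvectors for distinct eigenvalues are orthogonal, and a pairwise orthogonal set is
  finite. This makes \<open>Min\<close> and \<open>Max\<close> of the spectrum genuine
  bounds.\<close>

lemma finite_eigenvalues_self_adjoint:
  fixes T :: "'a::euclidean_space \<Rightarrow> 'a"
  assumes sa: "\<And>x y. T x \<bullet> y = x \<bullet> T y"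
  shows "finite (eigenvalues T)"
proof -
  have "\<forall>\<mu>\<in>eigenvalues T. \<exists>x. x \<noteq> 0 \<and> T x = \<mu> *\<^sub>R x"
    unfolding eigenvalues_def by blast
  then obtain v where v: "\<And>\<mu>. \<mu> \<in> eigenvalues T \<Longrightarrow> v \<mu> \<noteq> 0 \<and> T (v \<mu>) = \<mu> *\<^sub>R v \<mu>"
    by metis
  have orth: "v \<mu> \<bullet> v \<nu> = 0" if "\<mu> \<in> eigenvalues T" "\<nu> \<in> eigenvalues T" "\<mu> \<noteq> \<nu>" for \<mu> \<nu>
  proof -
    have "\<mu> * (v \<mu> \<bullet> v \<nu>) = \<nu> * (v \<mu> \<bullet> v \<nu>)"
      using sa[of "v \<mu>" "v \<nu>"] v[OF that(1)] v[OF that(2)] by simp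
    then show ?thesis
      using that(3) by simp
  qed
  have "inj_on v (eigenvalues T)"
    by (rule inj_onI) (metis orth v inner_eq_zero_iff)
  moreover have "pairwise orthogonal (v ` eigenvalues T)"
    unfolding pairwise_def orthogonal_def using orth by blast
  then have "finite (v ` eigenvalues T)"
    by (rule pairwise_orthogonal_imp_finite)
  ultimately show ?thesis
    using finite_imageD by blast
qed

section \<open>Spectral bounds for the Gram map of \<open>A\<close>\<close>

context
  fixes A :: "'a::euclidean_space \<Rightarrow> 'a"
  assumes lin: "linear A"
begin

lemma linear_adjoint_comp: "linear (adjoint A \<circ> A)"
  using lin adjoint_linear linear_compose by blast

lemma adjoint_comp_inner: "(adjoint A \<circ> A) x \<bullet> y = A x \<bullet> A y"
  using adjoint_clauses(2)[OF lin] by simp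

lemma adjoint_comp_self_adjoint: "(adjoint A \<circ> A) x \<bullet> y = x \<bullet> (adjoint A \<circ> A) y"
  by (metis adjoint_comp_inner inner_commute)

lemmas finite_eigenvalues_adjoint_comp =
  finite_eigenvalues_self_adjoint[OF adjoint_comp_self_adjoint]

lemma lambda_min_le: "lambda_min A * (norm x)\<^sup>2 \<le> (norm (A x))\<^sup>2"
proof -
  obtain \<mu> where \<mu>: "\<mu> \<in> eigenvalues (adjoint A \<circ> A)"
    "\<And>x. \<mu> * (norm x)\<^sup>2 \<le> (adjoint A \<circ> A) x \<bullet> x"
    using self_adjoint_least_eigenvalue[OF linear_adjoint_comp adjoint_comp_self_adjoint] by blast
  \<comment> \<open>It is enough that \<mu> is some eigenvalue; it need not be identified with the
    minimum.\<close>
  have "lambda_min A \<le> \<mu>"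
    unfolding lambda_min_def using finite_eigenvalues_adjoint_comp \<mu>(1) by (rule Min_le)
  then have "lambda_min A * (norm x)\<^sup>2 \<le> \<mu> * (norm x)\<^sup>2"
    by (rule mult_right_mono) simp
  also have "\<dots> \<le> (norm (A x))\<^sup>2"
    using \<mu>(2)[of x] by (simp only: adjoint_comp_inner power2_norm_eq_inner)
  finally show ?thesis .
qed

lemma le_lambda_max: "(norm (A x))\<^sup>2 \<le> lambda_max A * (norm x)\<^sup>2"
proof -
  obtain \<mu> where \<mu>: "\<mu> \<in> eigenvalues (adjoint A \<circ> A)"
    "\<And>x. (adjoint A \<circ> A) x \<bullet> x \<le> \<mu> * (norm x)\<^sup>2"
    using self_adjoint_greatest_eigenvalue[OF linear_adjoint_comp adjoint_comp_self_adjoint] by blast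
  have "\<mu> \<le> lambda_max A"
    unfolding lambda_max_def using finite_eigenvalues_adjoint_comp \<mu>(1) by (rule Max_ge)
  then have "\<mu> * (norm x)\<^sup>2 \<le> lambda_max A * (norm x)\<^sup>2"
    by (rule mult_right_mono) simp
  moreover have "(norm (A x))\<^sup>2 \<le> \<mu> * (norm x)\<^sup>2"
    using \<mu>(2)[of x] by (simp only: adjoint_comp_inner power2_norm_eq_inner)
  ultimately show ?thesis by simp
qed

text \<open>No eigenbasis is required: with \<open>g = adjoint A (A x)\<close>, Cauchy-Schwarz
  applied to \<open>A x\<close> and \<open>A g\<close> bounds the fourth power of the norm of
  \<open>g\<close>, and a factor \<open>(norm g)\<^sup>2\<close> cancels when \<open>g\<close> is
  nonzero.\<close>

lemma norm_adjoint_comp_le: "(norm (adjoint A (A x)))\<^sup>2 \<le> (lambda_max A)\<^sup>2 * (norm x)\<^sup>2"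
proof (cases "adjoint A (A x) = 0")
  case False
  define g where "g = adjoint A (A x)"
  have "((norm g)\<^sup>2)\<^sup>2 = (A x \<bullet> A g)\<^sup>2"
    using adjoint_comp_inner[of x g] by (simp add: g_def power2_norm_eq_inner)
  also have "\<dots> \<le> (norm (A x))\<^sup>2 * (norm (A g))\<^sup>2"
    using Cauchy_Schwarz_ineq by (simp add: power2_norm_eq_inner)
  also have "\<dots> \<le> (lambda_max A * (norm x)\<^sup>2) * (lambda_max A * (norm g)\<^sup>2)"
    using le_lambda_max order_trans[OF zero_le_power2 le_lambda_max[of x]]
    by (intro mult_mono) auto
  finally have "(norm g)\<^sup>2 * (norm g)\<^sup>2 \<le> ((lambda_max A)\<^sup>2 * (norm x)\<^sup>2) * (norm g)\<^sup>2"
    by (simp add: power2_eq_square mult_ac)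
  then show ?thesis
    unfolding g_def[symmetric]
    by (rule mult_right_le_imp_le) (use False in \<open>simp add: g_def\<close>)
qed simp

end

section \<open>The dual step size and the threshold on \<beta>\<close>

lemma one_plus_minus_square_pos:
  fixes \<tau> :: real
  assumes "0 < \<tau>" and "\<tau> < (1 + sqrt 5) / 2"
  shows "0 < 1 + \<tau> - \<tau>\<^sup>2"
proof -
  define s :: real where "s = sqrt 5"
  have s: "1 < s" "s\<^sup>2 = 5"
    by (simp_all add: s_def)
  \<comment> \<open>The golden ratio and its conjugate are the roots of the quadratic; this is its
    factorisation.\<close>
  have "0 < (\<tau> - (1 - s) / 2) * ((1 + s) / 2 - \<tau>)"
    using assms s(1) by (intro mult_pos_pos) (auto simp: s_def[symmetric])
  also have "\<dots> = \<tau> - \<tau>\<^sup>2 + (s\<^sup>2 - 1) / 4"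
    by (simp add: field_simps power2_eq_square)
  finally show ?thesis
    using s(2) by simp
qed

lemma theta_nonneg:
  assumes "0 < 1 + \<tau> - \<tau>\<^sup>2"
  shows "0 \<le> theta \<tau>"
  using assms by (cases "\<tau> \<le> 1") (auto simp: theta_def le_max_iff_disj)

text \<open>Adding \<tau> simplifies both entries of the maximum defining \<open>theta\<close>, to 1
  and \<open>\<tau> / (1 + \<tau> - \<tau>\<^sup>2)\<close>. For \<tau> at most 1 the former
  dominates and is below \<open>1 / \<tau>\<close>; otherwise the latter dominates, and another
  factor \<tau> only enlarges it.\<close>

lemma tau_plus_theta_le:
  assumes "0 < \<tau>" and pos: "0 < 1 + \<tau> - \<tau>\<^sup>2"
  shows "\<tau> + theta \<tau> \<le> max (1 / \<tau>) (\<tau>\<^sup>2 / (1 + \<tau> - \<tau>\<^sup>2))"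
proof -
  have "\<tau> + (\<tau> - 1) * \<tau>\<^sup>2 / (1 + \<tau> - \<tau>\<^sup>2) = \<tau> / (1 + \<tau> - \<tau>\<^sup>2)"
    using pos by (simp add: field_simps power2_eq_square)
  then have eq: "\<tau> + theta \<tau> = max 1 (\<tau> / (1 + \<tau> - \<tau>\<^sup>2))"
    unfolding theta_def by linarith
  show ?thesis
  proof (cases "\<tau> \<le> 1")
    case True
    have "\<tau>\<^sup>2 \<le> 1"
      using True assms(1) by (simp add: power_le_one)
    then have "\<tau> / (1 + \<tau> - \<tau>\<^sup>2) \<le> 1"
      using pos by simp
    moreover have "1 \<le> 1 / \<tau>"
      using True assms(1) by simp
    ultimately show ?thesis
      unfolding eq by linarith
  next
    case False
    have "\<tau> \<le> \<tau>\<^sup>2"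
      using False by (simp add: power2_eq_square)
    then have "\<tau> / (1 + \<tau> - \<tau>\<^sup>2) \<le> \<tau>\<^sup>2 / (1 + \<tau> - \<tau>\<^sup>2)"
      using pos by (simp add: divide_right_mono)
    moreover have "1 \<le> \<tau> / (1 + \<tau> - \<tau>\<^sup>2)"
    proof -
      have "1 \<le> \<tau>\<^sup>2"
        using False by (simp add: one_le_power)
      then show ?thesis
        using pos by simp
    qed
    ultimately show ?thesis
      unfolding eq by linarith
  qed
qed

text \<open>The second entry of \<open>beta_bar\<close> is the larger root of the quadratic
  \<open>\<beta> * (\<beta> + lambda_min A) - 2 * M * (lambda_max A)\<^sup>2\<close> in \<beta>,
  with \<open>M\<close> as in the proof.\<close>

lemma beta_bar_less_imp:
  assumes \<tau>: "0 < \<tau>" "0 < 1 + \<tau> - \<tau>\<^sup>2" and \<beta>: "beta_bar A \<tau> < \<beta>"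
  shows "2 * (\<tau> + theta \<tau>) * (lambda_max A)\<^sup>2 \<le> \<beta> * (\<beta> + lambda_min A)"
proof -
  define M where "M = max (1 / \<tau>) (\<tau>\<^sup>2 / (1 + \<tau> - \<tau>\<^sup>2))"
  have "sqrt ((lambda_min A)\<^sup>2 + M * (8 * (lambda_max A)\<^sup>2)) \<le> 2 * \<beta> + lambda_min A"
    using \<beta> unfolding beta_bar_def M_def by simp
  then have "(lambda_min A)\<^sup>2 + M * (8 * (lambda_max A)\<^sup>2) \<le> (2 * \<beta> + lambda_min A)\<^sup>2"
    by (rule sqrt_le_D)
  then have "2 * M * (lambda_max A)\<^sup>2 \<le> \<beta> * (\<beta> + lambda_min A)"
    by (simp add: power2_eq_square algebra_simps)
  moreover have "2 * (\<tau> + theta \<tau>) * (lambda_max A)\<^sup>2 \<le> 2 * M * (lambda_max A)\<^sup>2"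
    using tau_plus_theta_le[OF \<tau>] unfolding M_def by (intro mult_right_mono) auto
  ultimately show ?thesis by simp
qed

section \<open>The real-valued part of the augmented Lagrangian and its change in the Z- and
  multiplier steps\<close>

definition smooth_part ::
  "('a::euclidean_space \<Rightarrow> 'a) \<Rightarrow> 'a \<Rightarrow> real \<Rightarrow> 'a \<Rightarrow> 'a \<Rightarrow> 'a \<Rightarrow> real" where
  "smooth_part A D \<beta> W Z \<Lambda> =
     1 / 2 * (norm (D - A Z))\<^sup>2 - \<Lambda> \<bullet> (W - Z) + \<beta> / 2 * (norm (W - Z))\<^sup>2"

lemma aug_lagrangian_smooth_part:
  "aug_lagrangian \<Psi> \<Phi> A B C D \<beta> L S Z \<Lambda> =
     \<Psi> L + \<Phi> S + ereal (smooth_part A D \<beta> (B L + C S) Z \<Lambda>)"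
  by (simp add: aug_lagrangian_def smooth_part_def)

lemma norm_diff_square:
  fixes x y :: "'a::real_inner"
  shows "(norm (x - y))\<^sup>2 = (norm x)\<^sup>2 - 2 * (y \<bullet> x) + (norm y)\<^sup>2"
  by (simp add: power2_norm_eq_inner inner_diff_left inner_diff_right inner_commute[of x y])

text \<open>The function is quadratic in \<open>Z\<close>, so its second-order Taylor expansion is
  exact; the vector paired with \<open>d\<close> is the gradient. It yields both the optimality
  condition and the exact decrease of the Z-step.\<close>

lemma smooth_part_expand:
  assumes lin: "linear A"
  shows "smooth_part A D \<beta> W (Z + d) \<Lambda> = smooth_part A D \<beta> W Z \<Lambda>
    + (\<Lambda> - adjoint A (D - A Z) - \<beta> *\<^sub>R (W - Z)) \<bullet> d + ((norm (A d))\<^sup>2 + \<beta> * (norm d)\<^sup>2) / 2"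
proof -
  define g where "g = adjoint A (D - A Z)"
  have "A d \<bullet> (D - A Z) = g \<bullet> d"
    by (simp only: g_def adjoint_clauses(2)[OF lin] inner_commute[of "A d"])
  moreover have "(norm (D - A (Z + d)))\<^sup>2 = (norm (D - A Z))\<^sup>2 - 2 * (A d \<bullet> (D - A Z))
      + (norm (A d))\<^sup>2"
    using norm_diff_square[of "D - A Z" "A d"] by (simp add: linear_add[OF lin] diff_diff_eq)
  moreover have "(norm (W - (Z + d)))\<^sup>2 = (norm (W - Z))\<^sup>2 - 2 * ((W - Z) \<bullet> d) + (norm d)\<^sup>2"
    using norm_diff_square[of "W - Z" d] by (simp add: diff_diff_eq inner_commute)
  moreover have "\<Lambda> \<bullet> (W - (Z + d)) = \<Lambda> \<bullet> (W - Z) - \<Lambda> \<bullet> d"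
    by (simp add: inner_diff_right inner_add_right)
  ultimately show ?thesis
    unfolding smooth_part_def g_def[symmetric]
    by (simp only: inner_diff_left inner_scaleR_left) (simp add: field_simps)
qed

lemma smooth_part_minimizer:
  assumes lin: "linear A" and min: "\<And>X. smooth_part A D \<beta> W Z \<Lambda> \<le> smooth_part A D \<beta> W X \<Lambda>"
  shows "\<beta> *\<^sub>R (W - Z) = \<Lambda> - adjoint A (D - A Z)"
proof -
  define g where "g = \<Lambda> - adjoint A (D - A Z) - \<beta> *\<^sub>R (W - Z)"
  \<comment> \<open>Perturbing the minimiser along its own gradient \<open>g\<close> makes the
    linear coefficient the squared norm of \<open>g\<close>.\<close>
  have "0 \<le> (g \<bullet> g) * t + (((norm (A g))\<^sup>2 + \<beta> * (norm g)\<^sup>2) / 2) * t\<^sup>2" for t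
    using min[of "Z + t *\<^sub>R g"] unfolding smooth_part_expand[OF lin] g_def[symmetric]
    by (simp add: linear_scale[OF lin] power_mult_distrib algebra_simps)
  then have "g \<bullet> g = 0"
    by (rule quadratic_nonneg_imp_linear_coeff_zero)
  then show ?thesis
    by (simp add: g_def)
qed

lemma smooth_part_multiplier:
  "smooth_part A D \<beta> W Z (\<Lambda> - c *\<^sub>R (W - Z)) = smooth_part A D \<beta> W Z \<Lambda> + c * (norm (W - Z))\<^sup>2"
  by (simp add: smooth_part_def inner_diff_left power2_norm_eq_inner)

lemma smooth_part_decrease:
  assumes lin: "linear A" and \<tau>: "0 < \<tau>" "0 < 1 + \<tau> - \<tau>\<^sup>2"
    and \<beta>: "0 < \<beta>" "beta_bar A \<tau> < \<beta>"
    and \<Lambda>: "\<Lambda> = adjoint A (D - A Z)"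
    and min: "\<And>X. smooth_part A D \<beta> W Z' \<Lambda> \<le> smooth_part A D \<beta> W X \<Lambda>"
  shows "smooth_part A D \<beta> W Z' (\<Lambda> - (\<tau> * \<beta>) *\<^sub>R (W - Z')) + theta \<tau> * \<beta> * (norm (W - Z'))\<^sup>2
    \<le> smooth_part A D \<beta> W Z \<Lambda>"
proof -
  define d where "d = Z' - Z"
  define r where "r = W - Z'"
  have opt: "\<beta> *\<^sub>R r = \<Lambda> - adjoint A (D - A Z')"
    unfolding r_def using smooth_part_minimizer[OF lin min] .
  have "\<beta> *\<^sub>R r = adjoint A (A d)"
    unfolding opt \<Lambda> d_def using adjoint_linear[OF lin] lin by (simp add: linear_diff)
  then have "\<beta>\<^sup>2 * (norm r)\<^sup>2 = (norm (adjoint A (A d)))\<^sup>2"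
    by (metis norm_scaleR power_mult_distrib power2_abs)
  then have r_le: "\<beta>\<^sup>2 * (norm r)\<^sup>2 \<le> (lambda_max A)\<^sup>2 * (norm d)\<^sup>2"
    using norm_adjoint_comp_le[OF lin] by simp
  \<comment> \<open>The extra factor \<beta> produces the quantity bounded in \<open>r_le\<close>;
    it is cancelled at the end of the chain.\<close>
  have "\<beta> * ((\<tau> + theta \<tau>) * \<beta> * (norm r)\<^sup>2) = (\<tau> + theta \<tau>) * (\<beta>\<^sup>2 * (norm r)\<^sup>2)"
    by (simp add: power2_eq_square)
  also have "\<dots> \<le> (\<tau> + theta \<tau>) * ((lambda_max A)\<^sup>2 * (norm d)\<^sup>2)"
    using r_le theta_nonneg[OF \<tau>(2)] \<tau>(1) by (intro mult_left_mono) auto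
  also have "\<dots> = (2 * (\<tau> + theta \<tau>) * (lambda_max A)\<^sup>2) * (norm d)\<^sup>2 / 2"
    by simp
  also have "\<dots> \<le> \<beta> * (\<beta> + lambda_min A) * (norm d)\<^sup>2 / 2"
    using beta_bar_less_imp[OF \<tau> \<beta>(2)] by (intro divide_right_mono mult_right_mono) auto
  also have "\<dots> = \<beta> * ((lambda_min A * (norm d)\<^sup>2 + \<beta> * (norm d)\<^sup>2) / 2)"
    by (simp add: algebra_simps)
  also have "\<dots> \<le> \<beta> * (((norm (A d))\<^sup>2 + \<beta> * (norm d)\<^sup>2) / 2)"
    using lambda_min_le[OF lin, of d] \<beta>(1) by (intro mult_left_mono divide_right_mono) auto
  finally have key: "(\<tau> + theta \<tau>) * \<beta> * (norm r)\<^sup>2 \<le> ((norm (A d))\<^sup>2 + \<beta> * (norm d)\<^sup>2) / 2"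
    using \<beta>(1) by simp
  \<comment> \<open>Expanding around the minimiser \<open>Z'\<close> rather than around
    \<open>Z\<close> removes the linear term, by \<open>opt\<close>.\<close>
  have "smooth_part A D \<beta> W Z \<Lambda> =
    smooth_part A D \<beta> W Z' \<Lambda> + ((norm (A d))\<^sup>2 + \<beta> * (norm d)\<^sup>2) / 2"
    using smooth_part_expand[OF lin, of D \<beta> W Z' "- d" \<Lambda>] opt
    by (simp add: linear_neg[OF lin] r_def) (simp add: d_def)
  then show ?thesis
    using key unfolding smooth_part_multiplier unfolding r_def[symmetric]
    by (simp add: algebra_simps)
qed

section \<open>Descent of the potential over the first iteration\<close>

theorem proposition4p5:
  fixes \<Psi> \<Phi> :: "real ^ 'n ^ 'm \<Rightarrow> ereal"
    and A B C :: "real ^ 'n ^ 'm \<Rightarrow> real ^ 'n ^ 'm"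
    and D :: "real ^ 'n ^ 'm"
    and \<tau> \<beta> :: real
    and L0 S0 Z0 \<Lambda>0 L1 S1 Z1 \<Lambda>1 :: "real ^ 'n ^ 'm"
  assumes "\<forall>X. 0 \<le> \<Psi> X" and "eproper \<Psi>" and "lower_semicontinuous \<Psi>" and "econvex \<Psi>"
    and "\<forall>X. 0 \<le> \<Phi> X" and "eproper \<Phi>" and "lower_semicontinuous \<Phi>"
    and "linear A" and "linear B" and "linear C" and "inj B" and "inj C"
    and "0 < \<tau>" and "\<tau> < (1 + sqrt 5) / 2"
    and "0 < \<beta>" and "\<beta> > beta_bar A \<tau>"
    and "(L0, S0) \<in> edom \<Psi> \<times> edom \<Phi>"
    and "\<Lambda>0 = adjoint A (D - A Z0)"
    and "admm_step \<Psi> \<Phi> A B C D \<beta> \<tau> (S0, Z0, \<Lambda>0) (L1, S1, Z1, \<Lambda>1)"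
  shows "potential \<Psi> \<Phi> A B C D \<tau> \<beta> L1 S1 Z1 \<Lambda>1 \<le> potential \<Psi> \<Phi> A B C D \<tau> \<beta> L0 S0 Z0 \<Lambda>0"
proof -
  let ?AL = "aug_lagrangian \<Psi> \<Phi> A B C D \<beta>"
  let ?f = "smooth_part A D \<beta>"
  define W0 W1 where "W0 = B L0 + C S0" and "W1 = B L1 + C S1"
  have minL: "?AL L1 S0 Z0 \<Lambda>0 \<le> ?AL X S0 Z0 \<Lambda>0"
    and minS: "?AL L1 S1 Z0 \<Lambda>0 \<le> ?AL L1 X Z0 \<Lambda>0"
    and minZ: "?AL L1 S1 Z1 \<Lambda>0 \<le> ?AL L1 S1 X \<Lambda>0" for X
    using assms(19) unfolding admm_step_def by (auto simp: is_arg_min_linorder)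
  have \<Lambda>1: "\<Lambda>1 = \<Lambda>0 - (\<tau> * \<beta>) *\<^sub>R (W1 - Z1)"
    using assms(19) unfolding admm_step_def W1_def by simp
  have pos: "0 < 1 + \<tau> - \<tau>\<^sup>2"
    using one_plus_minus_square_pos assms(13,14) .
  have "?AL L1 S1 Z0 \<Lambda>0 \<le> ?AL L0 S0 Z0 \<Lambda>0"
    using minL minS order_trans by blast
  then have descent: "\<Psi> L1 + \<Phi> S1 + ereal (?f W1 Z0 \<Lambda>0) \<le> \<Psi> L0 + \<Phi> S0 + ereal (?f W0 Z0 \<Lambda>0)"
    by (simp add: aug_lagrangian_smooth_part W0_def W1_def)
  obtain a0 b0 where fin0: "\<Psi> L0 = ereal a0" "\<Phi> S0 = ereal b0"
    using assms(1,5,17) unfolding edom_def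
    by (cases "\<Psi> L0"; cases "\<Phi> S0") (auto dest: spec[of _ L0] spec[of _ S0])
  \<comment> \<open>Finiteness passes from the initial point to the first iterate through
    \<open>descent\<close>. It allows the values of \<Psi> and \<Phi> to be cancelled from
    \<open>minZ\<close>, leaving an inequality between reals.\<close>
  have "\<Psi> L1 + \<Phi> S1 \<noteq> \<infinity>"
    using descent unfolding fin0 by auto
  moreover have "0 \<le> \<Psi> L1" "0 \<le> \<Phi> S1"
    using assms(1,5) by auto
  ultimately obtain a1 b1 where fin1: "\<Psi> L1 = ereal a1" "\<Phi> S1 = ereal b1"
    by (cases "\<Psi> L1"; cases "\<Phi> S1") auto
  have "?f W1 Z1 \<Lambda>0 \<le> ?f W1 X \<Lambda>0" for X
    using minZ[of X] by (simp add: aug_lagrangian_smooth_part fin1 W1_def)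
  then have "?f W1 Z1 \<Lambda>1 + theta \<tau> * \<beta> * (norm (W1 - Z1))\<^sup>2 \<le> ?f W1 Z0 \<Lambda>0"
    unfolding \<Lambda>1 by (rule smooth_part_decrease[OF assms(8,13) pos assms(15,16,18)])
  \<comment> \<open>The penalty at the initial point only enlarges the right-hand side, so no bound
    on the initial residual is needed.\<close>
  moreover have "0 \<le> theta \<tau> * \<beta> * (norm (W0 - Z0))\<^sup>2"
    using theta_nonneg[OF pos] assms(15) by simp
  ultimately show ?thesis
    using descent
    by (simp add: potential_def aug_lagrangian_smooth_part fin0 fin1 W0_def W1_def)
qed

end
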